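(* Let $M=(S,A,P,\nu,\gamma,F,R_2)$ be a probabilistic attack graph, with decoy candidate set $D\subset S\setminus F$, set $W\subset (S\setminus(F\cup D))\times A$ of modifiable state-action pairs, and decoy budget $h\ge 0$. Suppose that the set of states where decoys are allocated is fixed to be all of $D$; that is, the defender's decoy allocations are restricted to $Y_+=\{\vec y\in Y \mid \vec y(s)>0 \text{ for all } s\in D\}$, so that $D^{\vec y}=D$. Then $V_1^{\pi}(\nu;\vec y)$ takes the same value $V_1^{\pi}(\nu)$ for all $\vec y\in Y_+$, and the defender's bi-level problem $$\max_{\vec x\in X,\ \vec y\in Y_+,\ \pi^\ast}\ V_1^{\pi^\ast}(\nu;\vec y)\quad\text{subject to}\quad \pi^\ast\in\operatorname{argmax}_{\pi} V_2^{\pi}(\nu;\vec x,\vec y)$$ (where, among the attacker's optimal policies, the one preferred by the defender is selected) is equivalent to the constrained optimization problem over policies $$\max_{\pi^\ast}\ V_1^{\pi^\ast}(\nu)\quad\text{subject to}\quad \pi^\ast\in\overline{\Pi}:=\bigcup_{\vec x\in X,\ \vec y\in Y_+}\Pi(\vec x,\vec y),$$ where $\Pi(\vec x,\vec y)$ is the set of policies $\pi$ attaining $\max_{\pi'}V_2^{\pi'}(\nu;\vec x,\vec y)$. Explicitly, the two problems have the same optimal value (supremum), and a policy $\pi^\ast$ is an optimal solution of the second problem if and only if there exist $\vec x\in X$ and $\vec y\in Y_+$ such that $(\vec x,\vec y,\pi^\ast)$ is an optimal solution of the first.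
   Context: A probabilistic attack graph is a tuple $M=(S,A,P,\nu,\gamma,F,R_2)$: $S$ is a finite set of states, $A$ a finite set of attack actions, $P:S\times A\to \mathrm{Dist}(S)$ a probabilistic transition function ($\mathrm{Dist}(Z)$ is the set of probability distributions on $Z$), $\nu\in\mathrm{Dist}(S)$ the initial distribution, $\gamma\in(0,1]$ a discount factor, $F\subset S$ the set of target states, and $R_2:F\times A\to\mathbb{R}_{\ge 0}$ the target reward, extended by $R_2(s,a)=0$ for $s\in S\setminus F$. There is a sink state $s_{\mathsf{sink}}\in S\setminus F$ with $P(s_{\mathsf{sink}}\mid s_{\mathsf{sink}},a)=1$ for all $a\in A$ and $P(s_{\mathsf{sink}}\mid s,a)=1$ for all $s\in F$, $a\in A$. Policies are Markovian randomized policies $\pi:S\to\mathrm{Dist}(A)$. $Y$ is the set of decoy allocations: vectors $\vec y\in\mathbb{R}_{\ge 0}^{|S|}$ with $\vec y(s)=0$ for $s\in S\setminus D$ and $\sum_{s}\vec y(s)\le h$. $X$ is the set of action reward modifications: vectors $\vec x\in\mathbb{R}_{\le 0}^{|S\times A|}$ with $\vec x(s,a)=0$ for $(s,a)\notin W$. Write $D^{\vec y}=\{s\in D\mid \vec y(s)\neq 0\}$. The attacker's perceptual planning problem is the MDP $M(\vec x,\vec y)=(S,A,P^{\vec y},\nu,\gamma,F\cup D^{\vec y},R_2^{\vec x,\vec y})$, where $P^{\vec y}$ is obtained from $P$ by only making all states of $D^{\vec y}$ absorbing (that is, $P^{\vec y}(s\mid s,a)=1$ for $s\in D^{\vec y}$,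 $a\in A$), and $R_2^{\vec x,\vec y}(s,a)=\vec y(s)$ if $\vec y(s)>0$, $R_2^{\vec x,\vec y}(s,a)=\vec x(s,a)$ if $\vec x(s,a)<0$, and $R_2^{\vec x,\vec y}(s,a)=R_2(s,a)$ otherwise (the first two cases are mutually exclusive). With $\mathbf{E}_\pi$ the expectation for the state-action process $(S_k,A_k)_{k\ge0}$ induced by $\pi$ in $M(\vec x,\vec y)$ with $S_0\sim\nu$, the attacker's perceptual value is $V_2^\pi(\nu;\vec x,\vec y)=\mathbf{E}_\pi\big[\sum_{k=0}^\infty\gamma^k R_2^{\vec x,\vec y}(S_k,A_k)\big]$, assumed well defined for all $\pi,\vec x,\vec y$. The defender's reward is $R_1^{\vec y}(s)=1$ if $s\in D^{\vec y}$ and $0$ otherwise, and the defender's value is $V_1^\pi(\nu;\vec y)=\mathbf{E}_\pi\big[\sum_{k=0}^\infty\gamma^k R_1^{\vec y}(S_k)\big]\in[0,\infty]$ (it does not depend on $\vec x$, since the transitions depend only on $\vec y$). Tie-breaking: if two policies have equal attacker value, the defender prefers the one with larger $V_1$. *)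

theory Defs
  imports "HOL-Probability.Probability"
begin

text \<open>The finite sets of states and actions are types of class \<open>finite\<close>. The reward is given on
  all state-action pairs; for an attack graph it is the target reward extended by zero.\<close>

record ('s, 'a) mdp =
  trans :: "'s \<Rightarrow> 'a \<Rightarrow> 's pmf"
  init :: "'s pmf"
  disc :: real
  targets :: "'s set"
  reward :: "'s \<Rightarrow> 'a \<Rightarrow> real"

definition prob_attack_graph :: "('s::finite, 'a::finite) mdp \<Rightarrow> bool" where
  "prob_attack_graph M \<longleftrightarrow>
     0 < disc M \<and> disc M \<le> 1 \<and>
     (\<forall>s\<in>targets M. \<forall>a. 0 \<le> reward M s a) \<and>
     (\<forall>s\<in>- targets M. \<forall>a. reward M s a = 0) \<and>
     (\<exists>sink\<in>- targets M.
        (\<forall>a. pmf (trans M sink a) sink = 1) \<and>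
        (\<forall>s\<in>targets M. \<forall>a. pmf (trans M s a) sink = 1))"

text \<open>Markovian randomized policies.\<close>

type_synonym ('s, 'a) policy = "'s \<Rightarrow> 'a pmf"


subsection \<open>The state-action process\<close>

definition choose_action :: "('s, 'a) policy \<Rightarrow> 's \<Rightarrow> ('s \<times> 'a) pmf" where
  "choose_action \<pi> s = map_pmf (Pair s) (\<pi> s)"

text \<open>Conditional law of \<open>(S\<^sub>n, A\<^sub>n)\<close> given the history \<open>\<omega> 0, \<dots>, \<omega> (n - 1)\<close>.\<close>

fun step_law :: "('s, 'a) mdp \<Rightarrow> ('s, 'a) policy \<Rightarrow> nat \<Rightarrow> (nat \<Rightarrow> 's \<times> 'a) \<Rightarrow> ('s \<times> 'a) pmf" where
  "step_law M \<pi> 0 \<omega> = bind_pmf (init M) (choose_action \<pi>)"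
| "step_law M \<pi> (Suc n) \<omega> = bind_pmf (trans M (fst (\<omega> n)) (snd (\<omega> n))) (choose_action \<pi>)"

lemma Ionescu_Tulcea_step_law:
  fixes M :: "('s::finite, 'a::finite) mdp"
  shows "Ionescu_Tulcea (\<lambda>n \<omega>. measure_pmf (step_law M \<pi> n \<omega>)) (\<lambda>_. count_space UNIV)"
proof
  fix n :: nat
  have "PiM {0..<n} (\<lambda>_. count_space (UNIV :: ('s \<times> 'a) set)) =
      count_space (PiE {0..<n} (\<lambda>_. UNIV))"
    by (rule count_space_PiM_finite) auto
  then show "(\<lambda>\<omega>. measure_pmf (step_law M \<pi> n \<omega>)) \<in>
      PiM {0..<n} (\<lambda>_. count_space UNIV) \<rightarrow>\<^sub>M subprob_algebra (count_space UNIV)"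
    by (simp add: measure_pmf_in_subprob_algebra)
qed

text \<open>Law of \<open>(S\<^sub>k, A\<^sub>k)\<^bsub>k \<ge> 0\<^esub>\<close> on the path space, by the Ionescu-Tulcea theorem.\<close>

definition path_measure :: "('s::finite, 'a::finite) mdp \<Rightarrow> ('s, 'a) policy \<Rightarrow> (nat \<Rightarrow> 's \<times> 'a) measure" where
  "path_measure M \<pi> =
     projective_family.lim UNIV
       (Ionescu_Tulcea.CI (\<lambda>n \<omega>. measure_pmf (step_law M \<pi> n \<omega>)) (\<lambda>_. count_space UNIV))
       (\<lambda>_. count_space UNIV)"

lemma sets_path_measure: "sets (path_measure M \<pi>) = sets (PiM UNIV (\<lambda>_. count_space UNIV))"
proof -
  interpret Ionescu_Tulcea "\<lambda>n \<omega>. measure_pmf (step_law M \<pi> n \<omega>)" "\<lambda>_. count_space UNIV"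
    by (rule Ionescu_Tulcea_step_law)
  show ?thesis by (simp add: path_measure_def)
qed

lemma step_law_cong:
  assumes "\<And>k. k < n \<Longrightarrow> \<omega> k = \<omega>' k"
  shows "step_law M \<pi> n \<omega> = step_law M \<pi> n \<omega>'"
  using assms by (cases n) auto

lemma emeasure_path_measure_cylinder:
  fixes M :: "('s::finite, 'a::finite) mdp" and w :: "nat \<Rightarrow> 's \<times> 'a"
  shows "emeasure (path_measure M \<pi>) {\<omega>. \<forall>k<n. \<omega> k = w k} =
    (\<Prod>k<n. ennreal (pmf (step_law M \<pi> k w) (w k)))"
proof -
  let ?P = "\<lambda>n \<omega>. measure_pmf (step_law M \<pi> n \<omega>)"
  let ?N = "\<lambda>_::nat. count_space (UNIV :: ('s \<times> 'a) set)"
  interpret Ionescu_Tulcea ?P ?N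
    by (rule Ionescu_Tulcea_step_law)
  have PiM_eq: "PiM {0..<n} ?N = count_space (PiE {0..<n} (\<lambda>_. UNIV))" for n
    by (rule count_space_PiM_finite) auto
  have sing: "{restrict w {0..<n}} \<in> sets (PiM {0..<n} ?N)" for n
    unfolding PiM_eq by auto
  have eP: "eP n \<omega> {restrict w {0..<Suc n}} =
      ennreal (pmf (step_law M \<pi> n w) (w n)) * indicator {restrict w {0..<n}} \<omega>"
    if \<omega>: "\<omega> \<in> space (PiM {0..<n} ?N)" for n \<omega>
  proof (cases "\<omega> = restrict w {0..<n}")
    case True
    have "fun_upd \<omega> n x = restrict w {0..<Suc n} \<longleftrightarrow> x = w n" for x
      unfolding True by (auto simp: fun_eq_iff restrict_def less_Suc_eq simp del: split_paired_All
          split: if_splits)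
    then have "(\<lambda>x. fun_upd \<omega> n x) -` {restrict w {0..<Suc n}} = {w n}" by auto
    moreover have "step_law M \<pi> n \<omega> = step_law M \<pi> n w"
      by (rule step_law_cong) (simp add: True)
    ultimately show ?thesis
      using emeasure_eP[OF \<omega> sing[of "Suc n"]] by (simp add: True emeasure_pmf_single)
  next
    case False
    have "fun_upd \<omega> n x \<noteq> restrict w {0..<Suc n}" for x
    proof
      assume eq: "fun_upd \<omega> n x = restrict w {0..<Suc n}"
      have "\<omega> k = restrict w {0..<n} k" for k
      proof (cases "k < n")
        case True
        then show ?thesis using fun_cong[OF eq, of k] by simp
      next
        case False
        then show ?thesis using \<omega> by (auto simp: space_PiM PiE_iff extensional_def)
      qed
      with False show False by auto
    qed
    then have "(\<lambda>x. fun_upd \<omega> n x) -` {restrict w {0..<Suc n}} = {}" by auto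
    with False show ?thesis
      using emeasure_eP[OF \<omega> sing[of "Suc n"]] by simp
  qed
  have C: "emeasure (C 0 n (\<lambda>_. undefined)) {restrict w {0..<n}} =
      (\<Prod>k<n. ennreal (pmf (step_law M \<pi> k w) (w k)))" for n
  proof (induction n)
    case 0
    have "restrict w {0..<0} = (\<lambda>_. undefined)" by auto
    then show ?case by (simp add: PiM_empty)
  next
    case (Suc n)
    have u: "(\<lambda>_. undefined) \<in> space (PiM {0..<0} ?N)" by (simp add: space_PiM)
    have sp: "space (C 0 n (\<lambda>_. undefined)) = space (PiM {0..<n} ?N)"
      using space_C[OF u, of n] by simp
    have st: "sets (C 0 n (\<lambda>_. undefined)) = sets (PiM {0..<n} ?N)"
      using sets_C[OF u, of n] by simp
    have m: "eP n \<in> measurable (C 0 n (\<lambda>_. undefined)) (subprob_algebra (PiM {0..<Suc n} ?N))"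
      using measurable_eP[of n] by (simp cong: measurable_cong_sets add: st)
    have ne: "space (C 0 n (\<lambda>_. undefined)) \<noteq> {}"
      using prob_space_C[OF u, of n] by (rule prob_space.not_empty)
    have "emeasure (C 0 (Suc n) (\<lambda>_. undefined)) {restrict w {0..<Suc n}} =
       (\<integral>\<^sup>+\<omega>. eP n \<omega> {restrict w {0..<Suc n}} \<partial>C 0 n (\<lambda>_. undefined))"
      using emeasure_bind[OF ne m sing] by simp
    also have "\<dots> = (\<integral>\<^sup>+\<omega>. ennreal (pmf (step_law M \<pi> n w) (w n)) * indicator {restrict w {0..<n}} \<omega>
        \<partial>C 0 n (\<lambda>_. undefined))"
      by (rule nn_integral_cong) (simp add: eP sp)
    also have "\<dots> = ennreal (pmf (step_law M \<pi> n w) (w n)) *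
        emeasure (C 0 n (\<lambda>_. undefined)) {restrict w {0..<n}}"
      by (rule nn_integral_cmult_indicator) (simp add: st sing)
    finally show ?case unfolding Suc.IH by (simp only: prod.lessThan_Suc mult.commute)
  qed
  have emb: "{\<omega>. \<forall>k<n. \<omega> k = w k} = PF.emb UNIV {0..<n} {restrict w {0..<n}}"
    by (auto simp: prod_emb_def space_PiM restrict_def fun_eq_iff simp del: split_paired_All
        split: if_splits)
  have "emeasure (path_measure M \<pi>) {\<omega>. \<forall>k<n. \<omega> k = w k} = emeasure (CI {0..<n}) {restrict w {0..<n}}"
    unfolding path_measure_def emb by (rule lim[OF _ sing]) simp
  also have "\<dots> = emeasure (C 0 n (\<lambda>_. undefined)) {restrict w {0..<n}}"
  proof -
    have "PF.emb {0..<n} {0..<n} {restrict w {0..<n}} = {restrict w {0..<n}}"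
      using sets.sets_into_space[OF sing[of n]] by (intro prod_emb_id) (simp add: space_PiM)
    then show ?thesis using emeasure_CI[of "{0..<n}" n, OF _ sing] by simp
  qed
  finally show ?thesis using C by simp
qed


subsection \<open>Values\<close>

text \<open>The total discounted reward along a path is the limit of the partial sums in the extended
  reals. It has an expectation if that limit exists almost surely and its positive and negative
  parts do not both have infinite integral.\<close>

definition path_reward_term :: "('s, 'a) mdp \<Rightarrow> (nat \<Rightarrow> 's \<times> 'a) \<Rightarrow> nat \<Rightarrow> ereal" where
  "path_reward_term M \<omega> k = ereal (disc M ^ k * reward M (fst (\<omega> k)) (snd (\<omega> k)))"

definition pos_value :: "('s::finite, 'a::finite) mdp \<Rightarrow> ('s, 'a) policy \<Rightarrow> ennreal" where
  "pos_value M \<pi> = (\<integral>\<^sup>+ \<omega>. e2ennreal (\<Sum>k. path_reward_term M \<omega> k) \<partial>path_measure M \<pi>)"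

definition neg_value :: "('s::finite, 'a::finite) mdp \<Rightarrow> ('s, 'a) policy \<Rightarrow> ennreal" where
  "neg_value M \<pi> = (\<integral>\<^sup>+ \<omega>. e2ennreal (- (\<Sum>k. path_reward_term M \<omega> k)) \<partial>path_measure M \<pi>)"

definition value_well_defined :: "('s::finite, 'a::finite) mdp \<Rightarrow> ('s, 'a) policy \<Rightarrow> bool" where
  "value_well_defined M \<pi> \<longleftrightarrow>
     (AE \<omega> in path_measure M \<pi>. summable (path_reward_term M \<omega>)) \<and>
     \<not> (pos_value M \<pi> = \<infinity> \<and> neg_value M \<pi> = \<infinity>)"

definition mdp_value :: "('s::finite, 'a::finite) mdp \<Rightarrow> ('s, 'a) policy \<Rightarrow> ereal" where
  "mdp_value M \<pi> = enn2ereal (pos_value M \<pi>) - enn2ereal (neg_value M \<pi>)"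


subsection \<open>Decoys and reward modifications\<close>

definition decoy_allocations :: "'s::finite set \<Rightarrow> real \<Rightarrow> ('s \<Rightarrow> real) set" where
  "decoy_allocations D h =
     {y. (\<forall>s. 0 \<le> y s) \<and> (\<forall>s. s \<notin> D \<longrightarrow> y s = 0) \<and> (\<Sum>s\<in>UNIV. y s) \<le> h}"

definition full_decoy_allocations :: "'s::finite set \<Rightarrow> real \<Rightarrow> ('s \<Rightarrow> real) set" where
  "full_decoy_allocations D h = {y \<in> decoy_allocations D h. \<forall>s\<in>D. 0 < y s}"

definition reward_modifications :: "('s \<times> 'a) set \<Rightarrow> ('s \<Rightarrow> 'a \<Rightarrow> real) set" where
  "reward_modifications W = {x. (\<forall>s a. x s a \<le> 0) \<and> (\<forall>s a. (s, a) \<notin> W \<longrightarrow> x s a = 0)}"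

definition decoy_states :: "'s set \<Rightarrow> ('s \<Rightarrow> real) \<Rightarrow> 's set" where
  "decoy_states D y = {s \<in> D. y s \<noteq> 0}"

definition perceived_mdp ::
    "('s, 'a) mdp \<Rightarrow> 's set \<Rightarrow> ('s \<Rightarrow> 'a \<Rightarrow> real) \<Rightarrow> ('s \<Rightarrow> real) \<Rightarrow> ('s, 'a) mdp" where
  "perceived_mdp M D x y = M\<lparr>
     trans := (\<lambda>s a. if s \<in> decoy_states D y then return_pmf s else trans M s a),
     targets := targets M \<union> decoy_states D y,
     reward := (\<lambda>s a. if y s > 0 then y s else if x s a < 0 then x s a else reward M s a)\<rparr>"

definition attacker_value ::
    "('s::finite, 'a::finite) mdp \<Rightarrow> 's set \<Rightarrow> ('s \<Rightarrow> 'a \<Rightarrow> real) \<Rightarrow> ('s \<Rightarrow> real) \<Rightarrow>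
     ('s, 'a) policy \<Rightarrow> ereal" where
  "attacker_value M D x y \<pi> = mdp_value (perceived_mdp M D x y) \<pi>"

definition attacker_optimal ::
    "('s::finite, 'a::finite) mdp \<Rightarrow> 's set \<Rightarrow> ('s \<Rightarrow> 'a \<Rightarrow> real) \<Rightarrow> ('s \<Rightarrow> real) \<Rightarrow>
     ('s, 'a) policy set" where
  "attacker_optimal M D x y = {\<pi>. is_arg_max (attacker_value M D x y) (\<lambda>_. True) \<pi>}"

definition defender_reward :: "'s set \<Rightarrow> ('s \<Rightarrow> real) \<Rightarrow> 's \<Rightarrow> real" where
  "defender_reward D y s = (if s \<in> decoy_states D y then 1 else 0)"

definition defender_value ::
    "('s::finite, 'a::finite) mdp \<Rightarrow> 's set \<Rightarrow> ('s \<Rightarrow> 'a \<Rightarrow> real) \<Rightarrow> ('s \<Rightarrow> real) \<Rightarrow>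
     ('s, 'a) policy \<Rightarrow> ennreal" where
  "defender_value M D x y \<pi> =
     (\<integral>\<^sup>+ \<omega>. (\<Sum>k. ennreal (disc M ^ k * defender_reward D y (fst (\<omega> k))))
        \<partial>path_measure (perceived_mdp M D x y) \<pi>)"


subsection \<open>The two optimization problems\<close>

text \<open>Maximizing jointly over \<open>(x, y, \<pi>)\<close> selects, among the attacker's optimal policies, one that
  the defender prefers.\<close>

definition bilevel_feasible ::
    "('s::finite, 'a::finite) mdp \<Rightarrow> 's set \<Rightarrow> ('s \<times> 'a) set \<Rightarrow> real \<Rightarrow>
     (('s \<Rightarrow> 'a \<Rightarrow> real) \<times> ('s \<Rightarrow> real) \<times> ('s, 'a) policy) set" where
  "bilevel_feasible M D W h =
     {(x, y, \<pi>). x \<in> reward_modifications W \<and> y \<in> full_decoy_allocations D h \<and>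
        \<pi> \<in> attacker_optimal M D x y}"

definition inducible_policies ::
    "('s::finite, 'a::finite) mdp \<Rightarrow> 's set \<Rightarrow> ('s \<times> 'a) set \<Rightarrow> real \<Rightarrow> ('s, 'a) policy set" where
  "inducible_policies M D W h =
     (\<Union>x\<in>reward_modifications W. \<Union>y\<in>full_decoy_allocations D h. attacker_optimal M D x y)"

end

theory Submission
  imports Defs
begin

text \<open>The law of the state-action process is determined by the initial distribution and the
  transitions, and the perceived transitions see an allocation only through its support in
  \<open>D\<close>. On full allocations that support is always \<open>D\<close>, so the defender's
  value is a function \<open>V\<close> of the policy alone (\<open>defender_value_cong\<close>,
  \<open>decoy_states_full\<close>). The bilevel problem thus maximizes the pullback of
  \<open>V\<close> along the projection of feasible triples to policies. The image of this
  projection is the set of inducible policies, so suprema and maximizers correspond.\<close>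

lemma path_measure_cong:
  assumes "trans M = trans N" and "init M = init N"
  shows "path_measure M \<pi> = path_measure N \<pi>"
proof -
  have "step_law M \<pi> n \<omega> = step_law N \<pi> n \<omega>" for n \<omega>
    by (cases n) (simp_all add: assms)
  then show ?thesis
    by (simp add: path_measure_def)
qed

text \<open>The modification \<open>x\<close> changes only the attacker's reward, which the
  defender's value never reads; the magnitudes in \<open>y\<close> enter neither the transitions nor
  the defender's reward.\<close>

lemma defender_value_cong:
  assumes "decoy_states D y = decoy_states D y'"
  shows "defender_value M D x y \<pi> = defender_value M D x' y' \<pi>"
proof -
  have "path_measure (perceived_mdp M D x y) \<pi> = path_measure (perceived_mdp M D x' y') \<pi>"
    by (rule path_measure_cong) (simp_all add: perceived_mdp_def assms)
  then show ?thesis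
    by (simp add: defender_value_def defender_reward_def assms)
qed

lemma decoy_states_full:
  assumes "y \<in> full_decoy_allocations D h"
  shows "decoy_states D y = D"
  using assms by (fastforce simp: full_decoy_allocations_def decoy_states_def)

theorem mainTheorem1:
  fixes M :: "('s::finite, 'a::finite) mdp"
    and D :: "'s set" and W :: "('s \<times> 'a) set" and h :: real
  assumes "prob_attack_graph M"
    and "D \<subseteq> - targets M"
    and "W \<subseteq> (- (targets M \<union> D)) \<times> UNIV"
    and "0 \<le> h"
    and "\<And>x y \<pi>. x \<in> reward_modifications W \<Longrightarrow> y \<in> decoy_allocations D h \<Longrightarrow>
           value_well_defined (perceived_mdp M D x y) \<pi>"
  shows "\<exists>V :: ('s, 'a) policy \<Rightarrow> ennreal.
    (\<forall>x\<in>reward_modifications W. \<forall>y\<in>full_decoy_allocations D h. \<forall>\<pi>.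
       defender_value M D x y \<pi> = V \<pi>) \<and>
    (SUP (x, y, \<pi>)\<in>bilevel_feasible M D W h. defender_value M D x y \<pi>) =
      (SUP \<pi>\<in>inducible_policies M D W h. V \<pi>) \<and>
    (\<forall>\<pi>. is_arg_max V (\<lambda>\<pi>'. \<pi>' \<in> inducible_policies M D W h) \<pi> \<longleftrightarrow>
       (\<exists>x\<in>reward_modifications W. \<exists>y\<in>full_decoy_allocations D h.
          is_arg_max (\<lambda>(x', y', \<pi>'). defender_value M D x' y' \<pi>')
            (\<lambda>z. z \<in> bilevel_feasible M D W h) (x, y, \<pi>)))"
proof -
  \<comment> \<open>The unit allocation may exceed the budget, but \<open>V\<close> has to be defined even when no full
    allocation is within it.\<close>
  define V where "V = defender_value M D (\<lambda>_ _. 0) (\<lambda>_. 1)"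
  \<comment> \<open>Both \<open>y\<close> and the constant allocation 1 have decoy set
    \<open>D\<close>.\<close>
  have V: "defender_value M D x y \<pi> = V \<pi>" if "y \<in> full_decoy_allocations D h" for x y \<pi>
    unfolding V_def
    by (rule defender_value_cong) (simp add: decoy_states_full[OF that], simp add: decoy_states_def)
  have feasible: "(x, y, \<pi>) \<in> bilevel_feasible M D W h \<longleftrightarrow> x \<in> reward_modifications W \<and>
      y \<in> full_decoy_allocations D h \<and> \<pi> \<in> attacker_optimal M D x y" for x y \<pi>
    by (simp add: bilevel_feasible_def)
  have inducible: "\<pi> \<in> inducible_policies M D W h \<longleftrightarrow>
      (\<exists>x y. (x, y, \<pi>) \<in> bilevel_feasible M D W h)" for \<pi>
    by (auto simp: inducible_policies_def feasible)
  have image: "inducible_policies M D W h = (\<lambda>(x, y, \<pi>). \<pi>) ` bilevel_feasible M D W h"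
    by (force simp: inducible)
  have "(SUP (x, y, \<pi>)\<in>bilevel_feasible M D W h. defender_value M D x y \<pi>) =
      (SUP (x, y, \<pi>)\<in>bilevel_feasible M D W h. V \<pi>)"
    by (rule SUP_cong) (auto simp: feasible V)
  also have "\<dots> = (SUP \<pi>\<in>inducible_policies M D W h. V \<pi>)"
    by (simp add: image image_image case_prod_unfold)
  finally have sup: "(SUP (x, y, \<pi>)\<in>bilevel_feasible M D W h. defender_value M D x y \<pi>) =
      (SUP \<pi>\<in>inducible_policies M D W h. V \<pi>)" .
  \<comment> \<open>A strictly better feasible triple carries a strictly better inducible policy;
    conversely, a better inducible policy extends to a feasible triple of the same value.\<close>
  have bilevel_arg_max: "is_arg_max (\<lambda>(x', y', \<pi>'). defender_value M D x' y' \<pi>')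
        (\<lambda>z. z \<in> bilevel_feasible M D W h) (x, y, \<pi>) \<longleftrightarrow>
      (x, y, \<pi>) \<in> bilevel_feasible M D W h \<and>
      is_arg_max V (\<lambda>\<pi>'. \<pi>' \<in> inducible_policies M D W h) \<pi>" for x y \<pi>
    unfolding is_arg_max_def inducible by (auto simp: feasible V) blast+
  \<comment> \<open>An optimal \<open>\<pi>\<close> is inducible, and any pair \<open>x\<close>,
    \<open>y\<close> inducing it serves as witness.\<close>
  have arg_max: "is_arg_max V (\<lambda>\<pi>'. \<pi>' \<in> inducible_policies M D W h) \<pi> \<longleftrightarrow>
       (\<exists>x\<in>reward_modifications W. \<exists>y\<in>full_decoy_allocations D h.
          is_arg_max (\<lambda>(x', y', \<pi>'). defender_value M D x' y' \<pi>')
            (\<lambda>z. z \<in> bilevel_feasible M D W h) (x, y, \<pi>))" for \<pi>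
    unfolding bilevel_arg_max using feasible inducible[of \<pi>] by (auto simp: is_arg_max_def)
  show ?thesis
    using V sup arg_max by blast
qed

end
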